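(* For every $n\ge 1$ and every bitrade $B\subset Q_3^n$, either $|B|\equiv 0 \pmod 3$ or $|B|\equiv 2^n \pmod 3$.
   Context: $Q_3$ is a set of $3$ symbols. A one-dimensional face of $Q_3^n$ is a set of $3$ words obtained by fixing the values of all coordinates but one. A unitrade is a set $U\subset Q_3^n$ whose intersection with every one-dimensional face has cardinality $0$ or $2$. The Hamming graph on $Q_3^n$ joins two words when they differ in exactly one coordinate. A bitrade is a unitrade $U$ such that the subgraph of the Hamming graph induced by $U$ is bipartite. *)

theory Defs
  imports "HOL-Number_Theory.Cong" "Graph_Theory.Graph_Theory"
begin

definition words :: "'a set \<Rightarrow> nat \<Rightarrow> 'a list set" where
  "words Q n = {w. set w \<subseteq> Q \<and> length w = n}"

definition one_dim_faces :: "'a set \<Rightarrow> nat \<Rightarrow> 'a list set set" where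
  "one_dim_faces Q n = {{w[i := a] | a. a \<in> Q} | w i. w \<in> words Q n \<and> i < n}"

definition unitrade :: "'a set \<Rightarrow> nat \<Rightarrow> 'a list set \<Rightarrow> bool" where
  "unitrade Q n U \<longleftrightarrow>
     U \<subseteq> words Q n \<and> (\<forall>F \<in> one_dim_faces Q n. card (U \<inter> F) = 0 \<or> card (U \<inter> F) = 2)"

text \<open>Undirected graphs are symmetric digraphs: every edge is a pair of opposite arcs.\<close>

definition hamming_graph :: "'a set \<Rightarrow> nat \<Rightarrow> 'a list pair_pre_digraph" where
  "hamming_graph Q n =
     \<lparr> pverts = words Q n,
       parcs = {(u, v). u \<in> words Q n \<and> v \<in> words Q n \<and> card {i. i < n \<and> u ! i \<noteq> v ! i} = 1} \<rparr>"

definition bipartite :: "('v, 'e) pre_digraph \<Rightarrow> bool" where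
  "bipartite G \<longleftrightarrow>
     (\<exists>X Y. verts G = X \<union> Y \<and> X \<inter> Y = {} \<and>
       (\<forall>e \<in> arcs G. tail G e \<in> X \<and> head G e \<in> Y \<or> tail G e \<in> Y \<and> head G e \<in> X))"

definition bitrade :: "'a set \<Rightarrow> nat \<Rightarrow> 'a list set \<Rightarrow> bool" where
  "bitrade Q n U \<longleftrightarrow> unitrade Q n U \<and> bipartite (with_proj (hamming_graph Q n) \<restriction> U)"

lemma graph_hamming_graph:
  assumes "finite Q"
  shows "graph (with_proj (hamming_graph Q n))"
proof -
  have fin: "finite (words Q n)"
    unfolding words_def using finite_lists_length_eq[OF assms] .
  have "finite {(u, v). u \<in> words Q n \<and> v \<in> words Q n \<and> card {i. i < n \<and> u ! i \<noteq> v ! i} = 1}"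
    by (rule finite_subset[OF _ finite_cartesian_product[OF fin fin]]) auto
  moreover have "{i. i < n \<and> u ! i \<noteq> v ! i} = {i. i < n \<and> v ! i \<noteq> u ! i}" for u v :: "'a list"
    by auto
  then have "symmetric (with_proj (hamming_graph Q n))"
    unfolding symmetric_def sym_def hamming_graph_def with_proj_simps by simp
  ultimately have "pair_graph (hamming_graph Q n)"
    using fin by unfold_locales (auto simp: hamming_graph_def)
  then interpret pair_graph "hamming_graph Q n" .
  show ?thesis by unfold_locales
qed

end

(* The two colour classes of a bitrade give a function g with values in {-1, 0, 1}, supported on B,
   whose sum over every one-dimensional face vanishes, so |B| is the sum of the squares of g. If f0,
   f1, f2 are the three slices of such a function in one direction, then f0 + f1 + f2 = 0 (mod 3)
   gives f0^2 + f1^2 + f2^2 = 2 (f0 - f1)^2 (mod 3), and f0 - f1 is a function of the same kind in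
   one dimension less. After n steps the sum of squares is 2^n k^2 (mod 3). *)
theory Submission
  imports Defs
begin

lemma sum_words_Suc:
  assumes "finite Q"
  shows "(\<Sum>w\<in>words Q (Suc n). h w) = (\<Sum>x\<in>Q. \<Sum>w\<in>words Q n. h (x # w))"
proof -
  have fin: "finite (words Q n)"
    unfolding words_def using finite_lists_length_eq[OF assms] .
  have "words Q (Suc n) = (\<lambda>(x, w). x # w) ` (Q \<times> words Q n)"
    by (force simp: words_def length_Suc_conv)
  moreover have "inj_on (\<lambda>(x, w). x # w) (Q \<times> words Q n)"
    by (auto simp: inj_on_def)
  ultimately show ?thesis
    by (simp add: sum.reindex sum.cartesian_product case_prod_unfold)
qed

text \<open>Modulo 3, \<open>z\<close> is \<open>-(x + y)\<close>, so the left side becomes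
  \<open>2 * (x^2 + x * y + y^2)\<close>, which differs from \<open>2 * (x - y)^2\<close> by
  \<open>6 * x * y\<close>.\<close>

lemma sum_three_squares_cong_3:
  fixes x y z :: int
  assumes "[x + y + z = 0] (mod 3)"
  shows "[x^2 + y^2 + z^2 = 2 * (x - y)^2] (mod 3)"
proof -
  obtain k where k: "x + y + z = 3 * k"
    using assms by (auto simp: cong_0_iff)
  have z: "z = 3 * k - x - y" using k by simp
  have "x^2 + y^2 + z^2 - 2 * (x - y)^2 = 3 * (3 * k^2 - 2 * k * (x + y) + 2 * x * y)"
    unfolding z by (simp add: power2_eq_square algebra_simps)
  then show ?thesis
    by (simp add: cong_iff_dvd_diff)
qed

text \<open>Induction on \<open>n\<close>, passing from \<open>g\<close> to the difference of two of
  its slices. Such a difference of functions with values in {-1, 0, 1} can take the values 2 and -2,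
  hence the statement for arbitrary integer-valued \<open>g\<close>.\<close>

lemma sum_squares_cong_if_face_sums_cong_0:
  fixes g :: "'a list \<Rightarrow> int"
  assumes "card Q = 3"
    and "\<And>w i. w \<in> words Q n \<Longrightarrow> i < n \<Longrightarrow> [(\<Sum>x\<in>Q. g (w[i := x])) = 0] (mod 3)"
  shows "\<exists>k. [(\<Sum>w\<in>words Q n. (g w)^2) = 2 ^ n * k^2] (mod 3)"
  using assms(2)
proof (induction n arbitrary: g)
  case 0
  have "words Q 0 = {[]}" by (auto simp: words_def)
  \<comment> \<open>The witness \<open>k\<close> is the single value \<open>g []\<close> that
    remains once all coordinates are gone.\<close>
  then have "[(\<Sum>w\<in>words Q 0. (g w)^2) = 2 ^ 0 * (g [])^2] (mod 3)" by simp
  then show ?case ..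
next
  case (Suc n)
  obtain a b c where Q: "Q = {a, b, c}" and ne: "a \<noteq> b" "a \<noteq> c" "b \<noteq> c"
    using assms(1) by (auto simp: card_3_iff)
  define h where "h w = g (a # w) - g (b # w)" for w
  have "\<exists>k. [(\<Sum>w\<in>words Q n. (h w)^2) = 2 ^ n * k^2] (mod 3)"
  proof (rule Suc.IH)
    fix w i assume w: "w \<in> words Q n" and i: "i < n"
    \<comment> \<open>Direction \<open>i\<close> in a slice is direction \<open>Suc i\<close> in the
      whole space, so each slice inherits vanishing face sums.\<close>
    have "[(\<Sum>x\<in>Q. g (y # w[i := x])) = 0] (mod 3)" if "y \<in> Q" for y
      using Suc.prems[of "y # w" "Suc i"] w i that by (auto simp: words_def)
    then have "[(\<Sum>x\<in>Q. g (a # w[i := x])) - (\<Sum>x\<in>Q. g (b # w[i := x])) = 0 - 0] (mod 3)"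
      by (intro cong_diff) (auto simp: Q)
    then show "[(\<Sum>x\<in>Q. h (w[i := x])) = 0] (mod 3)"
      by (simp add: h_def sum_subtractf)
  qed
  then obtain k where k: "[(\<Sum>w\<in>words Q n. (h w)^2) = 2 ^ n * k^2] (mod 3)" ..
  have "[(g (a # w))^2 + (g (b # w))^2 + (g (c # w))^2 = 2 * (h w)^2] (mod 3)"
    if "w \<in> words Q n" for w
  proof -
    have "a # w \<in> words Q (Suc n)" using that by (auto simp: words_def Q)
    \<comment> \<open>The face in direction \<open>0\<close> consists of \<open>a # w\<close>,
      \<open>b # w\<close> and \<open>c # w\<close>; its vanishing sum is what ties the three slices
      together.\<close>
    from Suc.prems[OF this, of 0] show ?thesis
      unfolding h_def using ne by (intro sum_three_squares_cong_3) (simp add: Q add.assoc)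
  qed
  then have "[(\<Sum>w\<in>words Q n. (g (a # w))^2 + (g (b # w))^2 + (g (c # w))^2)
      = (\<Sum>w\<in>words Q n. 2 * (h w)^2)] (mod 3)"
    by (rule cong_sum)
  moreover have "(\<Sum>w\<in>words Q (Suc n). (g w)^2)
      = (\<Sum>w\<in>words Q n. (g (a # w))^2 + (g (b # w))^2 + (g (c # w))^2)"
    using ne by (subst sum_words_Suc) (simp_all add: Q sum.distrib add.assoc)
  ultimately have "[(\<Sum>w\<in>words Q (Suc n). (g w)^2) = 2 * (\<Sum>w\<in>words Q n. (h w)^2)] (mod 3)"
    by (simp add: sum_distrib_left)
  also have "[2 * (\<Sum>w\<in>words Q n. (h w)^2) = 2 * (2 ^ n * k^2)] (mod 3)"
    using k by (rule cong_scalar_left)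
  finally show ?case by (auto simp: mult.assoc)
qed

text \<open>Give one colour class the sign 1 and the other the sign -1. A face that meets
  \<open>B\<close> does so in two adjacent words, which have opposite colours, so their signs
  cancel.\<close>

lemma bitrade_signing:
  assumes "bitrade Q n B"
  obtains g :: "'a list \<Rightarrow> int"
  where "\<And>w. (g w)^2 = of_bool (w \<in> B)"
    and "\<And>w i. w \<in> words Q n \<Longrightarrow> i < n \<Longrightarrow> (\<Sum>x\<in>Q. g (w[i := x])) = 0"
proof -
  let ?G = "with_proj (hamming_graph Q n) \<restriction> B"
  have sub: "B \<subseteq> words Q n"
    and face: "\<And>F. F \<in> one_dim_faces Q n \<Longrightarrow> card (B \<inter> F) = 0 \<or> card (B \<inter> F) = 2"
    and "bipartite ?G"
    using assms by (auto simp: bitrade_def unitrade_def)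
  then obtain X Y where XY: "verts ?G = X \<union> Y" "X \<inter> Y = {}"
    and arcs: "\<forall>e\<in>arcs ?G. tail ?G e \<in> X \<and> head ?G e \<in> Y \<or> tail ?G e \<in> Y \<and> head ?G e \<in> X"
    unfolding bipartite_def by blast
  have B: "B = X \<union> Y" using XY by simp
  define g :: "'a list \<Rightarrow> int" where "g w = of_bool (w \<in> X) - of_bool (w \<in> Y)" for w
  show thesis
  proof (rule that)
    show "(g w)^2 = of_bool (w \<in> B)" for w
      using XY(2) by (auto simp: g_def B)
    fix w i assume w: "w \<in> words Q n" and i: "i < n"
    have len: "length w = n" using w by (simp add: words_def)
    define F where "F = (\<lambda>x. w[i := x]) ` Q"
    have inj: "inj_on (\<lambda>x. w[i := x]) Q"
      by (rule inj_onI) (metis i len nth_list_update_eq)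
    have "F = {w[i := a] | a. a \<in> Q}" by (auto simp: F_def)
    then have F: "F \<in> one_dim_faces Q n"
      unfolding one_dim_faces_def using w i by blast
    have "(\<Sum>x\<in>Q. g (w[i := x])) = sum g F"
      unfolding F_def using inj by (simp add: sum.reindex)
    also have "\<dots> = 0"
    \<comment> \<open>\<open>Q\<close> is arbitrary here; over an infinite face the sum is 0 by
      convention.\<close>
    proof (cases "finite F")
      case True
      have "sum g F = sum g (B \<inter> F)"
        using True by (intro sum.mono_neutral_right) (auto simp: g_def B)
      also have "\<dots> = 0"
        using face[OF F]
      proof
        assume "card (B \<inter> F) = 2"
        then obtain u v where uv: "B \<inter> F = {u, v}" "u \<noteq> v" by (auto simp: card_2_iff)
        then have "u \<in> F" "v \<in> F" by auto
        then obtain x y where xy: "u = w[i := x]" "v = w[i := y]"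
          by (auto simp: F_def)
        then have "x \<noteq> y" using uv(2) by blast
        \<comment> \<open>Distinct words of one face differ exactly in its free coordinate, so they
          are joined by an edge.\<close>
        with xy have "{j. j < n \<and> u ! j \<noteq> v ! j} = {i}"
          using i len by (auto simp: nth_list_update split: if_splits)
        then have "(u, v) \<in> arcs ?G"
          using uv sub by (auto simp: hamming_graph_def)
        from arcs[rule_format, OF this] show ?thesis
          using uv XY(2) by (auto simp: g_def)
      qed (use True in simp)
      finally show ?thesis .
    qed simp
    finally show "(\<Sum>x\<in>Q. g (w[i := x])) = 0" .
  qed
qed

theorem mainTheorem2:
  fixes Q :: "'a set" and n :: nat and B :: "'a list set"
  assumes "card Q = 3"
    and "n \<ge> 1"
    and "bitrade Q n B"
  shows "[card B = 0] (mod 3) \<or> [card B = 2 ^ n] (mod 3)"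
proof -
  have "finite Q" using assms(1) by (simp add: card_ge_0_finite)
  then have fin: "finite (words Q n)"
    unfolding words_def by (rule finite_lists_length_eq)
  have sub: "B \<subseteq> words Q n" using assms(3) by (simp add: bitrade_def unitrade_def)
  obtain g :: "'a list \<Rightarrow> int" where g: "\<And>w. (g w)^2 = of_bool (w \<in> B)"
    and "\<And>w i. w \<in> words Q n \<Longrightarrow> i < n \<Longrightarrow> (\<Sum>x\<in>Q. g (w[i := x])) = 0"
    using bitrade_signing[OF assms(3)] by blast
  then obtain k where k: "[(\<Sum>w\<in>words Q n. (g w)^2) = 2 ^ n * k^2] (mod 3)"
    using sum_squares_cong_if_face_sums_cong_0[OF assms(1), of n g] by auto
  have "(\<Sum>w\<in>words Q n. (g w)^2) = int (card B)"
    using fin sub by (simp add: g Int_absorb1 of_bool_def sum.If_cases)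
  with k have card: "[int (card B) = 2 ^ n * k^2] (mod 3)" by simp
  \<comment> \<open>A square is 0 or 1 modulo 3, so the factor \<open>k^2\<close> leaves only the
    residues of 0 and \<open>2 ^ n\<close>.\<close>
  have "k mod 3 = 0 \<or> k mod 3 = 1 \<or> k mod 3 = 2" by presburger
  then have "[k = 0] (mod 3) \<or> [k = 1] (mod 3) \<or> [k = 2] (mod 3)"
    by (simp add: cong_def)
  then have "[k^2 = 0^2] (mod 3) \<or> [k^2 = 1^2] (mod 3) \<or> [k^2 = 2^2] (mod 3)"
    by (elim disj_forward cong_pow)
  then have "[k^2 = 0] (mod 3) \<or> [k^2 = 1] (mod 3)"
    by (simp add: cong_def)
  then have "[2 ^ n * k^2 = 2 ^ n * 0] (mod 3) \<or> [2 ^ n * k^2 = 2 ^ n * 1] (mod 3)"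
    by (elim disj_forward cong_scalar_left)
  then have "[int (card B) = 2 ^ n * 0] (mod 3) \<or> [int (card B) = 2 ^ n * 1] (mod 3)"
    by (elim disj_forward cong_trans[OF card])
  then show ?thesis
    using cong_int_iff[of "card B" 0 3] cong_int_iff[of "card B" "2 ^ n" 3] by simp
qed

end
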